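(* Let $d\ge1$ and consider the discrete Laplacian model on the $d$-dimensional hypercubic lattice of linear size $L$ with periodic boundary conditions, in which each site has $M=z+1$ possible states $m_v\in\{0,1,\dots,z\}$, where $z=2d$ is the coordination number of the lattice. Then the space of particle number configurations is strongly fragmented: the size of the largest connected component divided by the total number of configurations $D=M^{L^d}$ goes to zero exponentially with $L^d$, i.e. there exist constants $c>0$ and $L_0$ (depending only on $d$) such that for all $L\ge L_0$, $$\frac{\max_{\mathcal C}|\mathcal C|}{D}\;\le\; e^{-cL^d},$$ where the maximum is over all connected components $\mathcal C$ of the configuration space.
   Context: The lattice is the graph with vertex set $(\mathbb Z/L\mathbb Z)^d$ with nearest-neighbor edges; $\mathcal N_v$ is the set of the $z=2d$ neighbors of $v$. A configuration is $\mathbf m=(m_v)_v$ with integers $0\le m_v\le z$. There are two elementary updates at a vertex $v$: $v$ *fires*: $m_v\mapsto m_v-z$ and $m_{v'}\mapsto m_{v'}+1$ for all $v'\in\mathcal N_v$; $v$ *anti-fires*: the inverse, $m_v\mapsto m_v+z$ and $m_{v'}\mapsto m_{v'}-1$ for all $v'\in\mathcal N_v$. An update is allowed only if the resulting configuration satisfies $0\le m_w\le z$ for all $w$. Two configurations are in the same connected component if one can be reached from the other by a finite sequence of allowed updates (this is an equivalence relation since the inverse of an allowed update is allowed). *)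

theory Defs
  imports Complex_Main "HOL-Library.FuncSet"
begin

text \<open>
  The vertex set of the lattice is \<open>(\<int>/L\<int>)\<^sup>d\<close>, with residues represented by \<open>{0..<L}\<close>.
  Vertices and configurations are extensional functions, so that they can be counted with \<open>card\<close>.
\<close>

definition vertices :: "nat \<Rightarrow> nat \<Rightarrow> (nat \<Rightarrow> int) set" where
  "vertices d L = {..<d} \<rightarrow>\<^sub>E {0..<int L}"

text \<open>
  For \<open>L \<ge> 3\<close> a vertex has exactly \<open>2 * d\<close> neighbours (lemma \<open>card_neighbors\<close> below);
  for smaller \<open>L\<close> some of the \<open>2 * d\<close> translates coincide.
\<close>

definition neighbors :: "nat \<Rightarrow> nat \<Rightarrow> (nat \<Rightarrow> int) \<Rightarrow> (nat \<Rightarrow> int) set" where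
  "neighbors d L v = {v(i := (v i + s) mod int L) | i s. i < d \<and> s \<in> {-1, 1}}"

definition coordination :: "nat \<Rightarrow> nat" where
  "coordination d = 2 * d"

type_synonym config = "(nat \<Rightarrow> int) \<Rightarrow> int"

definition configs :: "nat \<Rightarrow> nat \<Rightarrow> config set" where
  "configs d L = vertices d L \<rightarrow>\<^sub>E {0..int (coordination d)}"

definition fire :: "nat \<Rightarrow> nat \<Rightarrow> (nat \<Rightarrow> int) \<Rightarrow> config \<Rightarrow> config" where
  "fire d L v m = (\<lambda>w. if w = v then m w - int (coordination d)
                       else if w \<in> neighbors d L v then m w + 1 else m w)"

definition antifire :: "nat \<Rightarrow> nat \<Rightarrow> (nat \<Rightarrow> int) \<Rightarrow> config \<Rightarrow> config" where
  "antifire d L v m = (\<lambda>w. if w = v then m w + int (coordination d)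
                           else if w \<in> neighbors d L v then m w - 1 else m w)"

definition allowed_updates :: "nat \<Rightarrow> nat \<Rightarrow> (config \<times> config) set" where
  "allowed_updates d L = {(m, m'). m \<in> configs d L \<and> m' \<in> configs d L \<and>
     (\<exists>v \<in> vertices d L. m' = fire d L v m \<or> m' = antifire d L v m)}"

definition connected_configs :: "nat \<Rightarrow> nat \<Rightarrow> (config \<times> config) set" where
  "connected_configs d L = Restr ((allowed_updates d L)\<^sup>*) (configs d L)"

definition components :: "nat \<Rightarrow> nat \<Rightarrow> config set set" where
  "components d L = configs d L // connected_configs d L"

lemma finite_vertices: "finite (vertices d L)"
  by (simp add: vertices_def finite_PiE)

lemma card_vertices: "card (vertices d L) = L ^ d"
  by (simp add: vertices_def card_PiE)

lemma finite_configs: "finite (configs d L)"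
  by (simp add: configs_def finite_PiE finite_vertices)

lemma card_configs: "card (configs d L) = (coordination d + 1) ^ (L ^ d)"
  by (simp add: configs_def card_PiE finite_vertices card_vertices nat_add_distrib)

lemma configs_nonempty: "configs d L \<noteq> {}"
  by (simp add: configs_def PiE_eq_empty_iff)

lemma neighbors_subset: "v \<in> vertices d L \<Longrightarrow> neighbors d L v \<subseteq> vertices d L"
proof
  fix w assume v: "v \<in> vertices d L" and "w \<in> neighbors d L v"
  then obtain i s where i: "i < d" and w: "w = v(i := (v i + s) mod int L)"
    by (auto simp: neighbors_def)
  have "v i \<in> {0..<int L}"
    using v i unfolding vertices_def by (simp add: PiE_iff)
  then have "0 < int L" by simp
  then have "(v i + s) mod int L \<in> {0..<int L}"
    by (simp only: atLeastLessThan_iff pos_mod_sign pos_mod_bound)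
  then have "w \<in> insert i {..<d} \<rightarrow>\<^sub>E {0..<int L}"
    using v unfolding vertices_def w by (intro PiE_fun_upd)
  then show "w \<in> vertices d L"
    using i by (simp add: vertices_def insert_absorb)
qed

lemma card_neighbors:
  assumes "v \<in> vertices d L" and "L \<ge> 3"
  shows "card (neighbors d L v) = coordination d"
proof -
  let ?f = "\<lambda>(i, s). v(i := (v i + s) mod int L)"
  have L: "int L \<ge> 3" using assms(2) by simp
  have ne: "(v i + s) mod int L \<noteq> v i" if "i < d" "s \<in> {-1, 1}" for i s
  proof
    assume eq: "(v i + s) mod int L = v i"
    then have "(v i + s) mod int L mod int L = v i mod int L"
      by (rule arg_cong)
    then have "int L dvd (v i + s) - v i"
      by (simp only: mod_mod_trivial mod_eq_dvd_iff)
    then have "int L dvd s" by simp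
    moreover have "s \<noteq> 0" "\<bar>s\<bar> = 1" using that(2) by auto
    ultimately show False using L dvd_imp_le_int[of s "int L"] by linarith
  qed
  have ne2: "(v i + 1) mod int L \<noteq> (v i + (-1)) mod int L" for i
  proof
    assume "(v i + 1) mod int L = (v i + (-1)) mod int L"
    then have "int L dvd (v i + 1) - (v i + (-1))"
      by (simp only: mod_eq_dvd_iff)
    then have "int L dvd 2" by simp
    then show False using L zdvd_imp_le[of "int L" 2] by linarith
  qed
  have "inj_on ?f ({..<d} \<times> {-1, 1})"
  proof (rule inj_onI, clarify)
    fix i s j t
    assume i: "i < d" and s: "s \<in> {-1, 1::int}" and j: "j < d" and t: "t \<in> {-1, 1::int}"
      and eq: "v(i := (v i + s) mod int L) = v(j := (v j + t) mod int L)"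
    have ij: "i = j"
    proof (rule ccontr)
      assume "i \<noteq> j"
      then have "(v i + s) mod int L = v i"
        using fun_cong[OF eq, of i] by simp
      with ne i s show False by blast
    qed
    then have "(v i + s) mod int L = (v i + t) mod int L"
      using fun_cong[OF eq, of i] by simp
    then have "s = t"
      using s t ne2[of i] by (elim insertE emptyE) simp_all
    with ij show "i = j \<and> s = t" by simp
  qed
  moreover have "neighbors d L v = ?f ` ({..<d} \<times> {-1, 1})"
    by (auto simp: neighbors_def image_iff)
  ultimately show ?thesis
    by (simp add: card_image coordination_def card_cartesian_product)
qed

lemma antifire_fire: "antifire d L v (fire d L v m) = m"
  by (auto simp: fire_def antifire_def)

lemma fire_antifire: "fire d L v (antifire d L v m) = m"
  by (auto simp: fire_def antifire_def)

lemma sym_allowed_updates: "sym (allowed_updates d L)"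
proof (rule symI)
  fix m m' assume "(m, m') \<in> allowed_updates d L"
  then obtain v where m: "m \<in> configs d L" "m' \<in> configs d L" "v \<in> vertices d L"
    and "m' = fire d L v m \<or> m' = antifire d L v m"
    by (auto simp: allowed_updates_def)
  then have "m = antifire d L v m' \<or> m = fire d L v m'"
    by (elim disjE) (simp_all add: antifire_fire fire_antifire)
  with m show "(m', m) \<in> allowed_updates d L"
    unfolding allowed_updates_def by blast
qed

lemma equiv_connected_configs: "equiv (configs d L) (connected_configs d L)"
proof (rule equivI)
  show "connected_configs d L \<subseteq> configs d L \<times> configs d L"
    by (auto simp: connected_configs_def)
  show "refl_on (configs d L) (connected_configs d L)"
    by (auto simp: refl_on_def connected_configs_def)
  show "sym (connected_configs d L)"
    using sym_rtrancl[OF sym_allowed_updates[of d L]]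
    by (auto simp: sym_def connected_configs_def)
  show "trans (connected_configs d L)"
    by (auto simp: trans_def connected_configs_def)
qed

lemma finite_components: "finite (components d L)"
  unfolding components_def
  by (rule finite_quotient[OF finite_configs]) (auto simp: connected_configs_def)

lemma components_nonempty: "components d L \<noteq> {}"
  using configs_nonempty by (simp add: components_def)

end

theory Submission
  imports Defs "HOL-Library.Disjoint_Sets" "HOL-Real_Asymp.Real_Asymp"
begin

text \<open>
  Fix linearly many disjoint blocks of sites and two patterns \<open>P \<noteq> Q\<close> on them. If every set of
  configurations that differ only by exchanging \<open>P\<close> and \<open>Q\<close> on blocks meets a component in at most
  \<open>K\<close> elements, then the component has at most \<open>K\<close> times as many elements as there are
  configurations with no block in the pattern \<open>Q\<close>, which is an exponentially small fraction.

  For \<open>d \<ge> 2\<close> one can take \<open>K = 1\<close> with \<open>P = (1, 0)\<close> and \<open>Q = (0, 1)\<close> on edges of disjoint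
  plaquettes. Two configurations of a component differ by \<open>\<Delta>h\<close> for an integer function \<open>h\<close>. If \<open>\<Delta>h\<close>
  is a sum of such dipoles, the Dirichlet energy of \<open>h\<close> is at most the sum of the increments \<open>\<bar>a\<bar>\<close>
  of \<open>h\<close> along the dipoles, whereas every plaquette contributes at least \<open>a\<^sup>2 + \<bar>a\<bar>\<close>; hence all \<open>a\<close>
  vanish and \<open>h\<close> is constant.

  For \<open>d = 1\<close> read \<open>m\<^sub>v - 1\<close> as a charge. Up to rotation of the ring, the sequence of signs of the
  defects (consecutive equal nonzero charges) is invariant, so \<open>K = L\<close> works for two patterns with
  the same outer charges but different defect sequences of equal length.
\<close>

section \<open>Counting configurations by switching block patterns\<close>

lemma shrink_factor:
  fixes x y M :: real
  assumes "M \<ge> 1" "x \<le> (x - y) * M"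
  shows "y \<le> (1 - 1 / M) * x"
  using assms by (simp add: field_simps)

lemma one_minus_inverse_nonneg:
  fixes M :: real
  assumes "M \<ge> 1"
  shows "0 \<le> 1 - 1 / M"
  using assms by simp

text \<open>Overwriting block \<open>i\<close> by \<open>Q\<close> while remembering its old
  contents is injective, and by disjointness the other blocks keep avoiding \<open>Q\<close>. So
  among the configurations avoiding \<open>Q\<close> on the other blocks, at least a fraction
  \<open>1 / card A ^ n\<close> shows \<open>Q\<close> on block \<open>i\<close>, and each block
  costs one factor.\<close>

lemma card_avoiding_pattern:
  fixes B :: "'i \<Rightarrow> 'v set" and A :: "'a set"
  assumes "finite I" and V: "finite V" and A: "finite A"
    and B: "\<And>i. i \<in> I \<Longrightarrow> B i \<subseteq> V" "\<And>i. i \<in> I \<Longrightarrow> card (B i) = n"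
    and disj: "disjoint_family_on B I"
    and Q: "Q \<in> V \<rightarrow> A"
  shows "real (card {m \<in> V \<rightarrow>\<^sub>E A. \<forall>i\<in>I. \<exists>v\<in>B i. m v \<noteq> Q v})
           \<le> (1 - 1 / real (card A ^ n)) ^ card I * real (card (V \<rightarrow>\<^sub>E A))"
  using assms(1) B disj
proof (induction I rule: finite_induct)
  case empty
  then show ?case by simp
next
  case (insert i I)
  let ?X = "{m \<in> V \<rightarrow>\<^sub>E A. \<forall>i\<in>I. \<exists>v\<in>B i. m v \<noteq> Q v}"
  let ?Y = "{m \<in> V \<rightarrow>\<^sub>E A. \<forall>i\<in>insert i I. \<exists>v\<in>B i. m v \<noteq> Q v}"
  let ?r = "1 - 1 / real (card A ^ n)"
  let ?f = "\<lambda>m. (override_on m Q (B i), restrict m (B i))"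
  have Bi: "B i \<subseteq> V" "card (B i) = n" using insert.prems by auto
  have dj: "B j \<inter> B i = {}" if "j \<in> I" for j
    using insert.prems(3) insert.hyps(2) that by (auto simp: disjoint_family_on_def)
  have finV: "finite (V \<rightarrow>\<^sub>E A)" using V A by (simp add: finite_PiE)
  have finX: "finite ?X" using finV by simp
  have "inj_on ?f ?X"
  proof (rule inj_onI)
    fix m m' assume "m \<in> ?X" "m' \<in> ?X" and eq: "?f m = ?f m'"
    show "m = m'"
    proof
      fix v
      have "override_on m Q (B i) v = override_on m' Q (B i) v"
        "restrict m (B i) v = restrict m' (B i) v"
        using eq by simp_all
      then show "m v = m' v"
        by (cases "v \<in> B i") simp_all
    qed
  qed
  moreover have "?f ` ?X \<subseteq> (?X - ?Y) \<times> (B i \<rightarrow>\<^sub>E A)"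
  proof (rule image_subsetI)
    fix m assume m: "m \<in> ?X"
    have "override_on m Q (B i) \<in> V \<rightarrow>\<^sub>E A"
      using m Q Bi(1) by (auto simp: override_on_def PiE_iff extensional_def)
    moreover have "\<exists>v\<in>B j. override_on m Q (B i) v \<noteq> Q v" if "j \<in> I" for j
    proof -
      obtain v where "v \<in> B j" "m v \<noteq> Q v" using m \<open>j \<in> I\<close> by auto
      with dj[OF that] show ?thesis
        by (intro bexI[of _ v]) (auto simp: override_on_def)
    qed
    moreover have "restrict m (B i) \<in> B i \<rightarrow>\<^sub>E A"
      using m Bi(1) by auto
    ultimately show "?f m \<in> (?X - ?Y) \<times> (B i \<rightarrow>\<^sub>E A)"
      by auto
  qed
  moreover have "finite ((?X - ?Y) \<times> (B i \<rightarrow>\<^sub>E A))"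
    using finX finite_subset[OF Bi(1) V] A by (simp add: finite_PiE)
  ultimately have "card ?X \<le> card ((?X - ?Y) \<times> (B i \<rightarrow>\<^sub>E A))"
    by (rule card_inj_on_le)
  also have "\<dots> = card (?X - ?Y) * card A ^ n"
    using finite_subset[OF Bi(1) V] Bi(2) by (simp add: card_cartesian_product card_PiE)
  also have "card (?X - ?Y) = card ?X - card ?Y"
    by (rule card_Diff_subset) (use finX in \<open>auto intro: finite_subset[OF _ finX]\<close>)
  finally have le: "card ?X \<le> (card ?X - card ?Y) * card A ^ n" .
  have YX: "card ?Y \<le> card ?X"
    by (rule card_mono[OF finX]) auto
  show ?case
  proof (cases "card A ^ n = 0")
    \<comment> \<open>Here the factor is 1 because \<open>1 / 0 = 0\<close>, and \<open>le\<close>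
      leaves no configuration to count.\<close>
    case True
    with le have "card ?X = 0" by simp
    with YX have "card ?Y = 0" by linarith
    show ?thesis
      unfolding \<open>card ?Y = 0\<close> True by simp
  next
    case False
    then have M: "real (card A ^ n) \<ge> 1" by linarith
    have "real (card ?X) \<le> (real (card ?X) - real (card ?Y)) * real (card A ^ n)"
      using of_nat_mono[OF le, where 'a = real] YX by (simp only: of_nat_mult of_nat_diff)
    then have "real (card ?Y) \<le> ?r * real (card ?X)"
      by (rule shrink_factor[OF M])
    also have "\<dots> \<le> ?r * (?r ^ card I * real (card (V \<rightarrow>\<^sub>E A)))"
    proof (intro mult_left_mono insert.IH)
      show "0 \<le> ?r" using M by (rule one_minus_inverse_nonneg)
      show "disjoint_family_on B I"
        by (rule disjoint_family_on_mono[OF _ insert.prems(3)]) blast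
    qed (use insert.prems in auto)
    finally show ?thesis
      using insert.hyps by (simp add: mult.assoc)
  qed
qed

text \<open>A normal form for exchanging the patterns: every block showing \<open>Q\<close> is reset
  to \<open>P\<close>. For disjoint blocks the fibres consist of configurations that differ by
  exchanging \<open>P\<close> and \<open>Q\<close> on blocks.\<close>

definition switch :: "'i set \<Rightarrow> ('i \<Rightarrow> 'v set) \<Rightarrow> ('v \<Rightarrow> 'a) \<Rightarrow> ('v \<Rightarrow> 'a) \<Rightarrow> ('v \<Rightarrow> 'a) \<Rightarrow> 'v \<Rightarrow> 'a" where
  "switch I B Q P m v = (if \<exists>i\<in>I. v \<in> B i \<and> (\<forall>u\<in>B i. m u = Q u) then P v else m v)"

lemma switch_block:
  assumes "disjoint_family_on B I" "i \<in> I" "v \<in> B i"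
  shows "switch I B Q P m v = (if \<forall>u\<in>B i. m u = Q u then P v else m v)"
proof -
  have "j = i" if "j \<in> I" "v \<in> B j" for j
    using assms that unfolding disjoint_family_on_def by blast
  then have "(\<exists>j\<in>I. v \<in> B j \<and> (\<forall>u\<in>B j. m u = Q u)) \<longleftrightarrow> (\<forall>u\<in>B i. m u = Q u)"
    using assms(2,3) by blast
  then show ?thesis by (simp only: switch_def)
qed

lemma switch_outside: "(\<And>i. i \<in> I \<Longrightarrow> v \<notin> B i) \<Longrightarrow> switch I B Q P m v = m v"
  by (auto simp: switch_def)

lemma switch_eq_cases:
  assumes "disjoint_family_on B I" "i \<in> I" "switch I B Q P m = switch I B Q P m'"
  shows "(\<forall>v\<in>B i. m v = m' v) \<or> (\<forall>v\<in>B i. m v = P v \<and> m' v = Q v)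
    \<or> (\<forall>v\<in>B i. m v = Q v \<and> m' v = P v)"
proof -
  have "(if \<forall>u\<in>B i. m u = Q u then P v else m v) = (if \<forall>u\<in>B i. m' u = Q u then P v else m' v)"
    if "v \<in> B i" for v
    using fun_cong[OF assms(3), of v] unfolding switch_block[OF assms(1,2) that] .
  note eq = this
  show ?thesis
  proof (cases "\<forall>u\<in>B i. m u = Q u"; cases "\<forall>u\<in>B i. m' u = Q u")
    assume "\<forall>u\<in>B i. m u = Q u" "\<forall>u\<in>B i. m' u = Q u"
    then show ?thesis by simp
  next
    assume 1: "\<forall>u\<in>B i. m u = Q u" and 2: "\<not> (\<forall>u\<in>B i. m' u = Q u)"
    have "P v = m' v" if "v \<in> B i" for v
      using eq[OF that] unfolding if_P[OF 1] if_not_P[OF 2] .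
    with 1 show ?thesis by simp
  next
    assume 1: "\<not> (\<forall>u\<in>B i. m u = Q u)" and 2: "\<forall>u\<in>B i. m' u = Q u"
    have "m v = P v" if "v \<in> B i" for v
      using eq[OF that] unfolding if_not_P[OF 1] if_P[OF 2] .
    with 2 show ?thesis by simp
  next
    assume 1: "\<not> (\<forall>u\<in>B i. m u = Q u)" and 2: "\<not> (\<forall>u\<in>B i. m' u = Q u)"
    have "m v = m' v" if "v \<in> B i" for v
      using eq[OF that] unfolding if_not_P[OF 1] if_not_P[OF 2] .
    then show ?thesis by simp
  qed
qed

lemma switch_eq_outside:
  assumes "switch I B Q P m = switch I B Q P m'" "\<And>i. i \<in> I \<Longrightarrow> v \<notin> B i"
  shows "m v = m' v"
proof -
  have "switch I B Q P n v = n v" for n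
    by (rule switch_outside) (rule assms(2))
  with fun_cong[OF assms(1), of v] show ?thesis by simp
qed

text \<open>Since \<open>P\<close> and \<open>Q\<close> differ on every block, switched
  configurations avoid \<open>Q\<close> everywhere. Thus \<open>S\<close> is covered by at most as
  many fibres as there are avoiding configurations, and \<open>1 - x \<le> exp (- x)\<close> turns
  the product of factors into an exponential.\<close>

lemma card_le_switch_fibres:
  fixes B :: "'i \<Rightarrow> 'v set" and A :: "'a set"
  assumes I: "finite I" and V: "finite V" and A: "finite A"
    and B: "\<And>i. i \<in> I \<Longrightarrow> B i \<subseteq> V" "\<And>i. i \<in> I \<Longrightarrow> card (B i) = n"
    and disj: "disjoint_family_on B I"
    and P: "P \<in> V \<rightarrow> A" and Q: "Q \<in> V \<rightarrow> A"
    and PQ: "\<And>i. i \<in> I \<Longrightarrow> \<exists>v\<in>B i. P v \<noteq> Q v"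
    and S: "S \<subseteq> V \<rightarrow>\<^sub>E A"
    and fibre: "\<And>b. card {m \<in> S. switch I B Q P m = b} \<le> K"
  shows "real (card S) \<le> real K * exp (- real (card I) / real (card A ^ n)) * real (card (V \<rightarrow>\<^sub>E A))"
proof -
  let ?f = "switch I B Q P"
  let ?X = "{m \<in> V \<rightarrow>\<^sub>E A. \<forall>i\<in>I. \<exists>v\<in>B i. m v \<noteq> Q v}"
  let ?r = "1 - 1 / real (card A ^ n)"
  have finV: "finite (V \<rightarrow>\<^sub>E A)" using V A by (simp add: finite_PiE)
  have finS: "finite S" using S finV by (rule finite_subset)
  have fS: "?f m \<in> ?X" if m: "m \<in> S" for m
  proof -
    have "?f m v \<in> A" if "v \<in> V" for v
      using m S P that by (auto simp: switch_def)
    moreover have "?f m v = undefined" if "v \<notin> V" for v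
    proof -
      have "?f m v = m v" by (rule switch_outside) (use B(1) that in blast)
      also have "\<dots> = undefined" using m S that by (auto intro: PiE_arb)
      finally show ?thesis .
    qed
    ultimately have "?f m \<in> V \<rightarrow>\<^sub>E A" by (simp add: PiE_iff extensional_def)
    moreover have "\<exists>v\<in>B i. ?f m v \<noteq> Q v" if "i \<in> I" for i
      using PQ[OF that] by (cases "\<forall>u\<in>B i. m u = Q u") (auto simp: switch_block[OF disj that])
    ultimately show ?thesis by simp
  qed
  have "card S = card (\<Union>b\<in>?f ` S. {m \<in> S. ?f m = b})"
    by (rule arg_cong[of _ _ card]) auto
  also have "\<dots> \<le> (\<Sum>b\<in>?f ` S. card {m \<in> S. ?f m = b})"
    by (rule card_UN_le) (use finS in simp)
  also have "\<dots> \<le> card (?f ` S) * K"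
    using sum_bounded_above[of "?f ` S" _ K] fibre by simp
  also have "\<dots> \<le> card ?X * K"
    using fS finV by (intro mult_right_mono card_mono) auto
  finally have "real (card S) \<le> real (card ?X * K)"
    by (rule of_nat_mono)
  also have "\<dots> = real K * real (card ?X)"
    by simp
  also have "\<dots> \<le> real K * (?r ^ card I * real (card (V \<rightarrow>\<^sub>E A)))"
    using card_avoiding_pattern[OF I V A B disj Q] by (intro mult_left_mono) auto
  also have "\<dots> \<le> real K * (exp (- real (card I) / real (card A ^ n)) * real (card (V \<rightarrow>\<^sub>E A)))"
  proof (intro mult_left_mono mult_right_mono)
    have "0 \<le> ?r"
    proof (cases "card A ^ n = 0")
      case True
      show ?thesis unfolding True by simp
    next
      case False
      then have "real (card A ^ n) \<ge> 1" by linarith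
      then show ?thesis by (rule one_minus_inverse_nonneg)
    qed
    then have "?r ^ card I \<le> exp (- 1 / real (card A ^ n)) ^ card I"
      using exp_ge_add_one_self[of "- 1 / real (card A ^ n)"] by (intro power_mono) auto
    also have "\<dots> = exp (- real (card I) / real (card A ^ n))"
      by (simp add: exp_of_nat_mult[symmetric])
    finally show "?r ^ card I \<le> exp (- real (card I) / real (card A ^ n))" .
  qed auto
  finally show ?thesis by (simp add: mult.assoc)
qed

section \<open>The lattice Laplacian\<close>

lemma neighbors_sym:
  assumes "v \<in> vertices d L" "w \<in> neighbors d L v"
  shows "v \<in> neighbors d L w"
proof -
  obtain i s where i: "i < d" and s: "s \<in> {-1, 1}" and w: "w = v(i := (v i + s) mod int L)"
    using assms(2) by (auto simp: neighbors_def)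
  have "0 \<le> v i" "v i < int L"
    using assms(1) i by (auto simp: vertices_def PiE_iff)
  then have "((v i + s) mod int L + - s) mod int L = v i"
    by (simp add: mod_simps)
  then have "v = w(i := (w i + - s) mod int L)"
    unfolding w by simp
  moreover have "- s \<in> {-1, 1}"
    using s by auto
  ultimately show ?thesis
    using i unfolding neighbors_def by blast
qed

lemma not_self_neighbor:
  assumes "v \<in> vertices d L" "L \<ge> 2"
  shows "v \<notin> neighbors d L v"
proof
  assume "v \<in> neighbors d L v"
  then obtain i s where i: "i < d" and s: "s \<in> {-1, 1::int}" and v: "v = v(i := (v i + s) mod int L)"
    by (auto simp: neighbors_def)
  have v0: "0 \<le> v i" "v i < int L"
    using assms(1) i by (auto simp: vertices_def PiE_iff)
  have "v i mod int L = (v i + s) mod int L"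
    using fun_cong[OF v, of i] v0 by simp
  then have "int L dvd s"
    by (simp add: mod_eq_dvd_iff)
  then show False
    using assms(2) s zdvd_imp_le[of "int L" 1] by auto
qed

text \<open>The sign is such that firing \<open>v\<close> adds the Laplacian of the indicator
  function of \<open>v\<close>.\<close>

definition laplacian :: "nat \<Rightarrow> nat \<Rightarrow> config \<Rightarrow> config" where
  "laplacian d L h w = (\<Sum>u\<in>neighbors d L w. h u) - int (coordination d) * h w"

lemma laplacian_add: "laplacian d L (\<lambda>u. g u + h u) w = laplacian d L g w + laplacian d L h w"
  by (simp add: laplacian_def sum.distrib algebra_simps)

lemma finite_neighbors: "w \<in> vertices d L \<Longrightarrow> finite (neighbors d L w)"
  by (rule finite_subset[OF neighbors_subset finite_vertices])

lemma laplacian_single: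
  assumes "v \<in> vertices d L" "w \<in> vertices d L" "L \<ge> 2"
  shows "laplacian d L (\<lambda>u. if u = v then c else 0) w =
    (if w = v then - int (coordination d) * c else if w \<in> neighbors d L v then c else 0)"
proof -
  have "v \<in> neighbors d L w \<longleftrightarrow> w \<in> neighbors d L v"
    using neighbors_sym assms by blast
  then show ?thesis
    using not_self_neighbor[OF assms(1,3)] finite_neighbors[OF assms(2)]
    by (auto simp: laplacian_def)
qed

text \<open>The function \<open>h\<close> records, at each vertex, the number of firings minus the
  number of anti-firings along the path.\<close>

lemma connected_laplacian:
  assumes "(m, m') \<in> (allowed_updates d L)\<^sup>*" "L \<ge> 2"
  shows "\<exists>h. \<forall>w\<in>vertices d L. m' w = m w + laplacian d L h w"
  using assms(1)
proof (induction rule: rtrancl_induct)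
  case base
  show ?case by (rule exI[of _ "\<lambda>_. 0"]) (simp add: laplacian_def)
next
  case (step m' m'')
  obtain h where h: "\<And>w. w \<in> vertices d L \<Longrightarrow> m' w = m w + laplacian d L h w"
    using step.IH by blast
  obtain v where v: "v \<in> vertices d L" and "m'' = fire d L v m' \<or> m'' = antifire d L v m'"
    using step.hyps by (auto simp: allowed_updates_def)
  then have "\<exists>c. \<forall>w. m'' w = m' w +
      (if w = v then - int (coordination d) * c else if w \<in> neighbors d L v then c else 0)"
  proof (elim disjE)
    assume "m'' = fire d L v m'"
    then show ?thesis by (intro exI[of _ 1]) (simp add: fire_def)
  next
    assume "m'' = antifire d L v m'"
    then show ?thesis by (intro exI[of _ "-1"]) (simp add: antifire_def)
  qed
  then obtain c where c: "\<And>w. m'' w = m' w +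
      (if w = v then - int (coordination d) * c else if w \<in> neighbors d L v then c else 0)"
    by blast
  show ?case
  proof (intro exI ballI)
    fix w assume w: "w \<in> vertices d L"
    show "m'' w = m w + laplacian d L (\<lambda>u. h u + (if u = v then c else 0)) w"
      unfolding laplacian_add laplacian_single[OF v w assms(2)] c h[OF w] by simp
  qed
qed

text \<open>Edges are oriented and occur in both directions, which is the source of the factors 2 in
  the energy estimates.\<close>

definition edges :: "nat \<Rightarrow> nat \<Rightarrow> ((nat \<Rightarrow> int) \<times> (nat \<Rightarrow> int)) set" where
  "edges d L = (SIGMA w:vertices d L. neighbors d L w)"

lemma finite_edges: "finite (edges d L)"
  unfolding edges_def by (rule finite_SigmaI[OF finite_vertices finite_neighbors])

lemma edges_swap: "prod.swap ` edges d L = edges d L"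
proof -
  have "(u, w) \<in> edges d L" if "(w, u) \<in> edges d L" for u w
    using that neighbors_sym[of w d L u] neighbors_subset[of w d L]
    unfolding edges_def by blast
  then show ?thesis
    by (auto simp: image_iff Bex_def)
qed

text \<open>Summation by parts. Reversing all edges equates the two sums of squares, and every
  vertex has exactly \<open>coordination d\<close> outgoing edges.\<close>

lemma dirichlet_energy:
  assumes "L \<ge> 3"
  shows "(\<Sum>(w, u)\<in>edges d L. (h u - h w)\<^sup>2) = - 2 * (\<Sum>w\<in>vertices d L. h w * laplacian d L h w)"
proof -
  have S: "(\<Sum>(w, u)\<in>edges d L. f w u) = (\<Sum>w\<in>vertices d L. \<Sum>u\<in>neighbors d L w. f w u)" for f :: "_ \<Rightarrow> _ \<Rightarrow> int"
    unfolding edges_def by (rule sum.Sigma[symmetric]) (auto intro: finite_vertices finite_neighbors)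
  have "(\<Sum>(w, u)\<in>edges d L. (h w)\<^sup>2) = (\<Sum>e\<in>prod.swap ` edges d L. (h (fst e))\<^sup>2)"
    unfolding edges_swap by (simp add: case_prod_unfold)
  also have "\<dots> = (\<Sum>(w, u)\<in>edges d L. (h u)\<^sup>2)"
    by (subst sum.reindex) (auto simp: case_prod_unfold)
  finally have swap: "(\<Sum>(w, u)\<in>edges d L. (h u)\<^sup>2) = (\<Sum>(w, u)\<in>edges d L. (h w)\<^sup>2)" ..
  have "(\<Sum>(w, u)\<in>edges d L. (h u - h w)\<^sup>2)
      = (\<Sum>(w, u)\<in>edges d L. (h u)\<^sup>2) + (\<Sum>(w, u)\<in>edges d L. (h w)\<^sup>2) - 2 * (\<Sum>(w, u)\<in>edges d L. h w * h u)"
    by (simp add: case_prod_unfold power2_diff sum.distrib sum_subtractf sum_distrib_left algebra_simps)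
  also have "\<dots> = 2 * (\<Sum>(w, u)\<in>edges d L. (h w)\<^sup>2) - 2 * (\<Sum>(w, u)\<in>edges d L. h w * h u)"
    unfolding swap by simp
  also have "(\<Sum>(w, u)\<in>edges d L. (h w)\<^sup>2) = (\<Sum>w\<in>vertices d L. int (coordination d) * (h w)\<^sup>2)"
    unfolding S using assms by (intro sum.cong refl) (simp add: card_neighbors)
  also have "(\<Sum>(w, u)\<in>edges d L. h w * h u) = (\<Sum>w\<in>vertices d L. h w * (\<Sum>u\<in>neighbors d L w. h u))"
    unfolding S by (simp add: sum_distrib_left)
  also have "2 * (\<Sum>w\<in>vertices d L. int (coordination d) * (h w)\<^sup>2) - 2 * \<dots>
      = - 2 * (\<Sum>w\<in>vertices d L. h w * laplacian d L h w)"
    by (simp add: laplacian_def right_diff_distrib sum_subtractf power2_eq_square mult.left_commute)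
  finally show ?thesis .
qed

text \<open>Zero energy makes \<open>h\<close> agree at \<open>w\<close> and at all its neighbours,
  which is all that the Laplacian at \<open>w\<close> sees.\<close>

lemma laplacian_eq_0_of_energy:
  assumes "L \<ge> 3" "(\<Sum>(w, u)\<in>edges d L. (h u - h w)\<^sup>2) = 0" "w \<in> vertices d L"
  shows "laplacian d L h w = 0"
proof -
  have "\<forall>e\<in>edges d L. (case e of (w, u) \<Rightarrow> (h u - h w)\<^sup>2) = 0"
    using assms(2) by (subst (asm) sum_nonneg_eq_0_iff) (auto simp: finite_edges)
  moreover have "(w, u) \<in> edges d L" if "u \<in> neighbors d L w" for u
    using assms(3) that by (simp add: edges_def)
  ultimately have "h u = h w" if "u \<in> neighbors d L w" for u
    using that by force
  then have "(\<Sum>u\<in>neighbors d L w. h u) = (\<Sum>u\<in>neighbors d L w. h w)"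
    by (intro sum.cong) auto
  then show ?thesis
    using assms(1,3) by (simp add: laplacian_def card_neighbors)
qed

lemma component_subset: "C \<in> components d L \<Longrightarrow> C \<subseteq> configs d L"
  using Union_quotient[OF equiv_connected_configs, of d L] unfolding components_def by blast

lemma component_connected:
  assumes "C \<in> components d L" "m \<in> C" "m' \<in> C"
  shows "(m, m') \<in> (allowed_updates d L)\<^sup>*"
proof -
  have "(m, m') \<in> connected_configs d L"
    using quotient_eq_iff[OF equiv_connected_configs] assms unfolding components_def by blast
  then show ?thesis by (simp add: connected_configs_def)
qed

section \<open>Dimension at least two\<close>

text \<open>Lower corners of disjoint unit squares. Their coordinates are at most
  \<open>L - 2\<close>, so the shifts below never wrap around the torus and can do without
  \<open>mod\<close>.\<close>

definition corners :: "nat \<Rightarrow> nat \<Rightarrow> (nat \<Rightarrow> int) set" where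
  "corners d L = {..<d} \<rightarrow>\<^sub>E (\<lambda>t. 2 * t) ` {0..<int (L div 2)}"

definition shift0 :: "(nat \<Rightarrow> int) \<Rightarrow> (nat \<Rightarrow> int)" where
  "shift0 v = v(0 := v 0 + 1)"

definition shift1 :: "(nat \<Rightarrow> int) \<Rightarrow> (nat \<Rightarrow> int)" where
  "shift1 v = v(1 := v 1 + 1)"

text \<open>The four sides of the unit square at \<open>v\<close> in directions 0 and 1, each in
  both orientations to match \<open>edges\<close>.\<close>

definition plaquette :: "(nat \<Rightarrow> int) \<Rightarrow> ((nat \<Rightarrow> int) \<times> (nat \<Rightarrow> int)) set" where
  "plaquette v = {(v, shift0 v), (shift0 v, v), (v, shift1 v), (shift1 v, v),
     (shift0 v, shift1 (shift0 v)), (shift1 (shift0 v), shift0 v),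
     (shift1 v, shift1 (shift0 v)), (shift1 (shift0 v), shift1 v)}"

lemma finite_corners: "finite (corners d L)"
  unfolding corners_def by (intro finite_PiE) auto

lemma card_corners: "card (corners d L) = (L div 2) ^ d"
  by (simp add: corners_def card_PiE card_image inj_on_def)

lemma corner_coordinate:
  assumes "v \<in> corners d L" "i < d"
  shows "even (v i)" "0 \<le> v i" "v i + 1 < int L"
proof -
  have "v i \<in> (\<lambda>t. 2 * t) ` {0..<int (L div 2)}"
    using assms by (simp add: corners_def PiE_iff)
  then obtain t where "v i = 2 * t" "0 \<le> t" "t < int (L div 2)"
    by auto
  moreover have "2 * int (L div 2) \<le> int L"
    by (simp add: zdiv_int)
  ultimately show "even (v i)" "0 \<le> v i" "v i + 1 < int L"
    by auto
qed

lemma corners_subset: "corners d L \<subseteq> vertices d L"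
proof
  fix v assume v: "v \<in> corners d L"
  then have "v \<in> extensional {..<d}"
    by (simp add: corners_def PiE_iff)
  with corner_coordinate[OF v] show "v \<in> vertices d L"
    by (fastforce simp: vertices_def PiE_iff)
qed

lemma upd_in_neighbors:
  assumes "v \<in> vertices d L" "i < d" "v i + 1 < int L"
  shows "v(i := v i + 1) \<in> neighbors d L v" "v(i := v i + 1) \<in> vertices d L"
proof -
  have "0 \<le> v i"
    using assms by (auto simp: vertices_def PiE_iff)
  then have "v(i := v i + 1) = v(i := (v i + 1) mod int L)"
    using assms(3) by simp
  with assms(2) show "v(i := v i + 1) \<in> neighbors d L v"
    unfolding neighbors_def by blast
  with neighbors_subset[OF assms(1)] show "v(i := v i + 1) \<in> vertices d L" ..
qed

lemma plaquette_subset: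
  assumes "v \<in> corners d L" "d \<ge> 2"
  shows "plaquette v \<subseteq> edges d L" "shift0 v \<in> vertices d L"
proof -
  note [simp] = corner_coordinate(3)[OF assms(1)]
  have v: "v \<in> vertices d L"
    using assms(1) corners_subset by blast
  have 0: "shift0 v \<in> neighbors d L v" "shift0 v \<in> vertices d L"
    unfolding shift0_def using upd_in_neighbors[OF v, of 0] assms(2) by simp_all
  have 1: "shift1 v \<in> neighbors d L v" "shift1 v \<in> vertices d L"
    unfolding shift1_def using upd_in_neighbors[OF v, of 1] assms(2) by simp_all
  have 01: "shift1 (shift0 v) \<in> neighbors d L (shift0 v)" "shift1 (shift0 v) \<in> vertices d L"
    unfolding shift1_def using upd_in_neighbors[OF 0(2), of 1] assms(2) by (simp_all add: shift0_def)
  have comm: "shift1 (shift0 v) = shift0 (shift1 v)"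
    by (auto simp: shift0_def shift1_def)
  have 10: "shift1 (shift0 v) \<in> neighbors d L (shift1 v)"
    unfolding comm shift0_def using upd_in_neighbors[OF 1(2), of 0] assms(2)
    by (simp add: shift1_def fun_upd_twist)
  show "plaquette v \<subseteq> edges d L"
    using v 0 1 01 10 neighbors_sym[OF v 0(1)] neighbors_sym[OF v 1(1)]
      neighbors_sym[OF 0(2) 01(1)] neighbors_sym[OF 1(2) 10]
    by (simp add: plaquette_def edges_def)
  show "shift0 v \<in> vertices d L" by fact
qed

lemma corner_eqI:
  assumes "v \<in> corners d L" "w \<in> corners d L" "d \<ge> 2"
    and "v(0 := v 0 div 2, 1 := v 1 div 2) = w(0 := w 0 div 2, 1 := w 1 div 2)"
  shows "v = w"
proof
  fix i
  have "even (v j)" "even (w j)" if "j < 2" for j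
    using corner_coordinate(1) assms(1-3) that by auto
  then have "even (v 0)" "even (w 0)" "even (v 1)" "even (w 1)"
    by simp_all
  moreover have "v 0 div 2 = w 0 div 2" "v 1 div 2 = w 1 div 2"
    using fun_cong[OF assms(4), of 0] fun_cong[OF assms(4), of 1] by simp_all
  ultimately have "v 0 = w 0" "v 1 = w 1"
    by presburger+
  then show "v i = w i"
    using fun_cong[OF assms(4), of i] by (cases "i = 0"; cases "i = 1") auto
qed

text \<open>Halving coordinates 0 and 1 forgets the position inside a plaquette. Every vertex
  therefore identifies its corner, which gives disjointness of plaquettes and of dipoles.\<close>

lemma plaquette_corner:
  assumes "v \<in> corners d L" "d \<ge> 2" "e \<in> plaquette v"
  shows "(fst e)(0 := fst e 0 div 2, 1 := fst e 1 div 2) = v(0 := v 0 div 2, 1 := v 1 div 2)"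
proof -
  have "even (v 0)" "even (v 1)"
    using corner_coordinate(1) assms(1,2) by auto
  then have "(v 0 + 1) div 2 = v 0 div 2" "(v 1 + 1) div 2 = v 1 div 2"
    by (auto elim!: evenE)
  then show ?thesis
    using assms(3) by (auto simp: plaquette_def shift0_def shift1_def)
qed

lemma disjoint_plaquettes:
  assumes "d \<ge> 2"
  shows "disjoint_family_on plaquette (corners d L)"
  unfolding disjoint_family_on_def
proof (intro ballI impI)
  fix v w assume vw: "v \<in> corners d L" "w \<in> corners d L" "v \<noteq> w"
  show "plaquette v \<inter> plaquette w = {}"
  proof (rule ccontr)
    assume "plaquette v \<inter> plaquette w \<noteq> {}"
    then obtain e where e: "e \<in> plaquette v" "e \<in> plaquette w"
      by blast
    have "v = w"
      using plaquette_corner[OF vw(1) assms e(1)] plaquette_corner[OF vw(2) assms e(2)]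
      by (intro corner_eqI[OF vw(1,2) assms]) simp
    with vw(3) show False ..
  qed
qed

text \<open>
  The four increments around a plaquette add up to zero, so if one of them is a nonzero integer \<open>a\<close>,
  the other three carry at least \<open>\<bar>a\<bar>\<close> further units of energy.
\<close>

lemma plaquette_energy:
  "(\<Sum>(w, u)\<in>plaquette v. (h u - h w)\<^sup>2)
    \<ge> 2 * ((h (shift0 v) - h v)\<^sup>2 + \<bar>h (shift0 v) - h v\<bar>)" for h :: config
proof -
  define a b c e where "a = h (shift0 v) - h v" and "b = h (shift1 (shift0 v)) - h (shift0 v)"
    and "c = h (shift1 v) - h (shift1 (shift0 v))" and "e = h v - h (shift1 v)"
  have ne: "shift0 v \<noteq> v" "shift1 v \<noteq> v" "shift1 (shift0 v) \<noteq> v" "shift0 v \<noteq> shift1 v"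
    "shift1 (shift0 v) \<noteq> shift0 v" "shift1 (shift0 v) \<noteq> shift1 v"
    by (auto simp: shift0_def shift1_def fun_eq_iff)
  have "(\<Sum>(w, u)\<in>plaquette v. (h u - h w)\<^sup>2) = 2 * (a\<^sup>2 + b\<^sup>2 + c\<^sup>2 + e\<^sup>2)"
    using ne ne[symmetric] unfolding plaquette_def a_def b_def c_def e_def
    by (simp add: power2_commute)
  also have "\<dots> \<ge> 2 * (a\<^sup>2 + \<bar>a\<bar>)"
  proof -
    have "\<bar>x\<bar> \<le> x\<^sup>2" for x :: int
      using self_le_power[of "\<bar>x\<bar>" 2] by (cases "x = 0") auto
    then have "\<bar>b\<bar> + \<bar>c\<bar> + \<bar>e\<bar> \<le> b\<^sup>2 + c\<^sup>2 + e\<^sup>2"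
      by (intro add_mono)
    moreover have "\<bar>a\<bar> \<le> \<bar>b\<bar> + \<bar>c\<bar> + \<bar>e\<bar>"
      unfolding a_def b_def c_def e_def by linarith
    ultimately have "\<bar>a\<bar> \<le> b\<^sup>2 + c\<^sup>2 + e\<^sup>2" by (rule order_trans[rotated])
    then show ?thesis by simp
  qed
  finally show ?thesis unfolding a_def .
qed

definition dipole :: "(nat \<Rightarrow> int) \<Rightarrow> (nat \<Rightarrow> int) set" where
  "dipole v = {v, shift0 v}"

lemma disjoint_dipoles:
  assumes "d \<ge> 2"
  shows "disjoint_family_on dipole (corners d L)"
  unfolding disjoint_family_on_def
proof (intro ballI impI)
  fix v w assume vw: "v \<in> corners d L" "w \<in> corners d L" "v \<noteq> w"
  show "dipole v \<inter> dipole w = {}"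
  proof (rule ccontr)
    assume "dipole v \<inter> dipole w \<noteq> {}"
    then obtain u where u: "u \<in> dipole v" "u \<in> dipole w"
      by blast
    have "\<exists>e\<in>plaquette x. fst e = u" if "u \<in> dipole x" for x
      using that unfolding dipole_def plaquette_def by fastforce
    with u obtain e f where e: "e \<in> plaquette v" "f \<in> plaquette w" "fst e = u" "fst f = u"
      by meson
    have "v = w"
      using plaquette_corner[OF vw(1) assms e(1)] plaquette_corner[OF vw(2) assms e(2)] e(3,4)
      by (intro corner_eqI[OF vw(1,2) assms]) simp
    with vw(3) show False ..
  qed
qed

text \<open>Corners have an even coordinate 0, so the parity of that coordinate tells the two ends
  of a dipole apart and one global function shows \<open>(1, 0)\<close> on all of them.\<close>

definition dipole_plus :: "(nat \<Rightarrow> int) \<Rightarrow> int" where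
  "dipole_plus v = (if even (v 0) then 1 else 0)"

definition dipole_minus :: "(nat \<Rightarrow> int) \<Rightarrow> int" where
  "dipole_minus v = (if even (v 0) then 0 else 1)"

text \<open>The Laplacian of \<open>h\<close> is a superposition of dipoles of strength -1, 0 or 1.
  The energy of \<open>h\<close> is bounded above by pairing increments with strengths and below by
  the disjoint plaquettes; both bounds together force the increments along the dipoles to
  vanish.\<close>

lemma dipole_rigidity:
  assumes d: "d \<ge> 2" and L: "L \<ge> 3"
    and h: "\<And>w. w \<in> vertices d L \<Longrightarrow> m' w = m w + laplacian d L h w"
    and sw: "switch (corners d L) dipole dipole_minus dipole_plus m = switch (corners d L) dipole dipole_minus dipole_plus m'"
    and w: "w \<in> vertices d L"
  shows "m w = m' w"
proof -
  let ?f = "laplacian d L h"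
  let ?a = "\<lambda>v. h (shift0 v) - h v"
  let ?E = "\<Sum>(w, u)\<in>edges d L. (h u - h w)\<^sup>2"
  have out: "?f w = 0" if "w \<in> vertices d L - \<Union> (dipole ` corners d L)" for w
    using switch_eq_outside[OF sw, of w] h[of w] that by auto
  have loc: "?f (shift0 v) = - ?f v \<and> \<bar>?f v\<bar> \<le> 1" if v: "v \<in> corners d L" for v
  proof -
    have V: "v \<in> vertices d L" "shift0 v \<in> vertices d L"
      using v corners_subset plaquette_subset(2)[OF v d] by auto
    have "even (v 0)" using corner_coordinate(1)[OF v] d by simp
    then show ?thesis
      using switch_eq_cases[OF disjoint_dipoles[OF d] v sw] h[OF V(1)] h[OF V(2)]
      by (auto simp: dipole_def dipole_plus_def dipole_minus_def shift0_def)
  qed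
  have sub: "\<Union> (dipole ` corners d L) \<subseteq> vertices d L"
    using corners_subset plaquette_subset(2)[OF _ d] by (auto simp: dipole_def)
  have "(\<Sum>w\<in>vertices d L. h w * ?f w) = (\<Sum>w\<in>\<Union> (dipole ` corners d L). h w * ?f w)"
    by (rule sum.mono_neutral_right) (use finite_vertices sub out in auto)
  also have "\<dots> = (\<Sum>v\<in>corners d L. \<Sum>w\<in>dipole v. h w * ?f w)"
    using disjoint_dipoles[OF d]
    by (intro sum.UNION_disjoint) (auto simp: finite_corners disjoint_family_on_def dipole_def)
  also have "\<dots> = (\<Sum>v\<in>corners d L. - ?a v * ?f v)"
  proof (rule sum.cong[OF refl])
    fix v assume "v \<in> corners d L"
    moreover have "v \<noteq> shift0 v" by (auto simp: shift0_def fun_eq_iff)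
    ultimately show "(\<Sum>w\<in>dipole v. h w * ?f w) = - ?a v * ?f v"
      using loc by (simp add: dipole_def algebra_simps)
  qed
  finally have hf: "(\<Sum>w\<in>vertices d L. h w * ?f w) = (\<Sum>v\<in>corners d L. - ?a v * ?f v)" .
  \<comment> \<open>Summation by parts pairs each increment \<open>?a v\<close> with the dipole
    strength \<open>?f v\<close>.\<close>
  have "?E = 2 * (\<Sum>v\<in>corners d L. ?a v * ?f v)"
    unfolding dirichlet_energy[OF L] hf mult_minus_left sum_negf by simp
  also have "\<dots> \<le> 2 * (\<Sum>v\<in>corners d L. \<bar>?a v\<bar>)"
  proof (intro mult_left_mono sum_mono)
    fix v assume "v \<in> corners d L"
    then have "\<bar>?a v\<bar> * \<bar>?f v\<bar> \<le> \<bar>?a v\<bar> * 1"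
      using loc by (intro mult_left_mono) auto
    then show "?a v * ?f v \<le> \<bar>?a v\<bar>"
      using abs_ge_self[of "?a v * ?f v"] by (simp add: abs_mult)
  qed simp
  finally have upper: "?E \<le> 2 * (\<Sum>v\<in>corners d L. \<bar>?a v\<bar>)" .
  have "2 * (\<Sum>v\<in>corners d L. (?a v)\<^sup>2 + \<bar>?a v\<bar>)
      \<le> (\<Sum>v\<in>corners d L. \<Sum>(w, u)\<in>plaquette v. (h u - h w)\<^sup>2)"
    unfolding sum_distrib_left[where r = 2] by (rule sum_mono) (rule plaquette_energy)
  also have "\<dots> = (\<Sum>(w, u)\<in>\<Union> (plaquette ` corners d L). (h u - h w)\<^sup>2)"
  proof (rule sum.UNION_disjoint[symmetric])
    show "\<forall>v\<in>corners d L. \<forall>w\<in>corners d L. v \<noteq> w \<longrightarrow> plaquette v \<inter> plaquette w = {}"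
      using disjoint_plaquettes[OF d] unfolding disjoint_family_on_def .
  qed (simp_all add: finite_corners plaquette_def)
  also have "\<dots> \<le> ?E"
    using plaquette_subset(1)[OF _ d] by (intro sum_mono2 finite_edges) auto
  \<comment> \<open>The absolute values cancel between the lower and the upper bound, and only the
    squares remain.\<close>
  finally have "(\<Sum>v\<in>corners d L. (?a v)\<^sup>2) \<le> 0"
    using upper by (simp add: sum.distrib)
  then have "(\<Sum>v\<in>corners d L. (?a v)\<^sup>2) = 0"
    by (intro antisym sum_nonneg) auto
  then have "\<forall>v\<in>corners d L. ?a v = 0"
    by (subst (asm) sum_nonneg_eq_0_iff) (auto simp: finite_corners)
  \<comment> \<open>So far only the increments along the dipoles vanish; the pairing formula now
    makes the whole energy zero.\<close>
  then have "?E = 0"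
    unfolding dirichlet_energy[OF L] hf by simp
  then show ?thesis
    using laplacian_eq_0_of_energy[OF L _ w] h[OF w] by simp
qed

text \<open>By rigidity, configurations of one component with equal switched images coincide, so
  \<open>K = 1\<close>. A dipole has two sites and hence \<open>(2 * d + 1) ^ 2\<close> possible
  contents.\<close>

lemma component_bound_high_dim:
  assumes d: "d \<ge> 2" and L: "L \<ge> 3" and C: "C \<in> components d L"
  shows "real (card C) \<le> exp (- real ((L div 2) ^ d) / real ((2 * d + 1) ^ 2)) * real (card (configs d L))"
proof -
  let ?sw = "switch (corners d L) dipole dipole_minus dipole_plus"
  have fibre: "card {m \<in> C. ?sw m = b} \<le> 1" for b
  proof -
    have "m = m'" if m: "m \<in> C" "m' \<in> C" "?sw m = ?sw m'" for m m'
    proof -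
      obtain h where h: "\<And>w. w \<in> vertices d L \<Longrightarrow> m' w = m w + laplacian d L h w"
        using connected_laplacian[OF component_connected[OF C m(1,2)]] L by auto
      have "m \<in> configs d L" "m' \<in> configs d L"
        using component_subset[OF C] m by auto
      then show ?thesis
        unfolding configs_def
        by (rule PiE_ext) (rule dipole_rigidity[OF d L h m(3)])
    qed
    moreover have "finite {m \<in> C. ?sw m = b}"
      using finite_subset[OF component_subset[OF C] finite_configs] by simp
    ultimately show ?thesis
      by (simp add: card_le_Suc0_iff_eq)
  qed
  have "real (card C) \<le> real 1 * exp (- real (card (corners d L)) / real (card {0..int (coordination d)} ^ 2))
      * real (card (vertices d L \<rightarrow>\<^sub>E {0..int (coordination d)}))"
  proof (rule card_le_switch_fibres[OF finite_corners finite_vertices _ _ _ disjoint_dipoles[OF d] _ _ _ _ fibre])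
    show "dipole v \<subseteq> vertices d L" if "v \<in> corners d L" for v
      using that corners_subset plaquette_subset(2)[OF that d] by (auto simp: dipole_def)
    have ne: "v \<noteq> shift0 v" for v by (auto simp: shift0_def fun_eq_iff)
    show "card (dipole v) = 2" for v
      using ne by (simp add: dipole_def)
    show "\<exists>u\<in>dipole v. dipole_plus u \<noteq> dipole_minus u" for v
      by (auto simp: dipole_def dipole_plus_def dipole_minus_def)
    show "C \<subseteq> vertices d L \<rightarrow>\<^sub>E {0..int (coordination d)}"
      using component_subset[OF C] by (simp add: configs_def)
  qed (use d in \<open>auto simp: dipole_plus_def dipole_minus_def coordination_def\<close>)
  then show ?thesis
    by (simp add: card_corners configs_def coordination_def nat_add_distrib add.commute)
qed

section \<open>Dimension one\<close>

text \<open>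
  The letters \<open>0\<close>, \<open>1\<close>, \<open>2\<close> stand for the charges \<open>-\<close>, \<open>0\<close>, \<open>+\<close>. A defect is a nonzero charge that
  repeats the previous nonzero charge.
\<close>

fun last_charge :: "int \<Rightarrow> int list \<Rightarrow> int" where
  "last_charge s [] = s"
| "last_charge s (x # xs) = last_charge (if x = 1 then s else x) xs"

fun defects :: "int \<Rightarrow> int list \<Rightarrow> int list" where
  "defects s [] = []"
| "defects s (x # xs) =
    (if x = 1 then defects s xs else if x = s then x # defects x xs else defects x xs)"

text \<open>On a ring the charge preceding the first letter is the last charge of the word itself.
  The start value 0 survives only in a word without charges, which has no defects.\<close>

definition cyclic_defects :: "int list \<Rightarrow> int list" where
  "cyclic_defects w = defects (last_charge 0 w) w"

lemma last_charge_append: "last_charge s (u @ w) = last_charge (last_charge s u) w"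
  by (induction u arbitrary: s) auto

lemma defects_append: "defects s (u @ w) = defects s u @ defects (last_charge s u) w"
  by (induction u arbitrary: s) auto

lemma length_defects: "length (defects s w) \<le> length w"
  by (induction w arbitrary: s) (auto simp: le_SucI)

text \<open>Moving the first letter to the end keeps its cyclic predecessor among the charges, so a
  defect at that letter just moves from the front of the sequence to the back.\<close>

lemma cyclic_defects_rotate1: "\<exists>k. cyclic_defects (rotate1 w) = rotate k (cyclic_defects w)"
proof (cases w)
  case Nil
  then show ?thesis by (auto intro: exI[of _ 0])
next
  case (Cons x xs)
  show ?thesis
  proof (cases "x = 1")
    case True
    then have "cyclic_defects (rotate1 w) = rotate 0 (cyclic_defects w)"
      by (simp add: Cons cyclic_defects_def last_charge_append defects_append)
    then show ?thesis ..
  next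
    case False
    let ?l = "if x = last_charge x xs then [x] else []"
    have "cyclic_defects w = ?l @ defects x xs"
      using False by (simp add: Cons cyclic_defects_def)
    moreover have "cyclic_defects (rotate1 w) = defects x xs @ ?l"
      using False by (simp add: Cons cyclic_defects_def last_charge_append defects_append)
    ultimately have "cyclic_defects (rotate1 w) = rotate (length ?l) (cyclic_defects w)"
      by (simp only: rotate_append)
    then show ?thesis ..
  qed
qed

lemma cyclic_defects_rotate: "\<exists>k. cyclic_defects (rotate n w) = rotate k (cyclic_defects w)"
proof (induction n)
  case 0
  show ?case by (rule exI[of _ 0]) simp
next
  case (Suc n)
  then obtain k where "cyclic_defects (rotate n w) = rotate k (cyclic_defects w)" by blast
  moreover obtain j where "cyclic_defects (rotate1 (rotate n w)) = rotate j (cyclic_defects (rotate n w))"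
    using cyclic_defects_rotate1 by blast
  ultimately show ?case by (auto simp: rotate_rotate intro!: exI[of _ "j + k"])
qed

text \<open>In all four cases the charges in the window alternate before and after the firing, with
  the same first and the same last charge. Only the first can be a defect, and this depends on the
  incoming charge alone.\<close>

lemma cyclic_defects_fire:
  assumes "a \<in> {0, 1}" "c \<in> {0, 1}"
  shows "cyclic_defects ((a + 1) # 0 # (c + 1) # r) = cyclic_defects (a # 2 # c # r)"
proof -
  have loc: "last_charge s [a + 1, 0, c + 1] = last_charge s [a, 2, c]"
    "defects s [a + 1, 0, c + 1] = defects s [a, 2, c]" for s
    using assms by auto
  have "last_charge s ([a + 1, 0, c + 1] @ r) = last_charge s ([a, 2, c] @ r)"
    "defects s ([a + 1, 0, c + 1] @ r) = defects s ([a, 2, c] @ r)" for s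
    unfolding last_charge_append defects_append loc by (rule refl)+
  then have "cyclic_defects ([a + 1, 0, c + 1] @ r) = cyclic_defects ([a, 2, c] @ r)"
    unfolding cyclic_defects_def by (simp only:)
  then show ?thesis
    by (simp only: append_Cons append_Nil)
qed

section \<open>The ring as a cyclic word\<close>

definition site :: "nat \<Rightarrow> nat \<Rightarrow> int" where
  "site t = restrict (\<lambda>_. int t) {..<1}"

definition word :: "nat \<Rightarrow> config \<Rightarrow> int list" where
  "word L m = map (\<lambda>t. m (site t)) [0..<L]"

lemma site_apply: "site t 0 = int t"
  by (simp add: site_def)

lemma site_eq_iff: "site s = site t \<longleftrightarrow> s = t"
  using site_apply by (metis of_nat_eq_iff)

lemma vertices_1: "vertices 1 L = site ` {..<L}"
proof (intro equalityI subsetI)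
  fix v assume v: "v \<in> vertices 1 L"
  then have "v 0 \<in> {0..<int L}"
    by (simp add: vertices_def PiE_iff)
  moreover have "v i = undefined" if "i \<noteq> 0" for i
    using v that by (auto simp: vertices_def intro: PiE_arb)
  ultimately have "v = site (nat (v 0))" "nat (v 0) < L"
    by (auto simp: site_def fun_eq_iff)
  then show "v \<in> site ` {..<L}" by blast
qed (auto simp: vertices_def site_def PiE_iff extensional_def)

lemma neighbors_1:
  assumes "t < L"
  shows "neighbors 1 L (site t) = {site ((t + 1) mod L), site ((t + L - 1) mod L)}"
proof -
  have upd: "(site t)(0 := int k) = site k" for k
    by (auto simp: site_def fun_eq_iff)
  have "(int t + 1) mod int L = int ((t + 1) mod L)"
    by (simp add: zmod_int add.commute)
  moreover have "(int t - 1) mod int L = (int t - 1 + int L) mod int L"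
    by simp
  then have "(int t - 1) mod int L = int ((t + L - 1) mod L)"
    using assms by (simp add: zmod_int of_nat_diff algebra_simps)
  moreover have "neighbors 1 L (site t) = (\<lambda>s. (site t)(0 := (site t 0 + s) mod int L)) ` {1, -1}"
    unfolding neighbors_def less_one by blast
  then have "neighbors 1 L (site t) = {(site t)(0 := (int t + 1) mod int L), (site t)(0 := (int t - 1) mod int L)}"
    by (simp add: site_apply)
  ultimately show ?thesis
    by (simp add: upd)
qed

lemma rotate_word: "rotate s (word L m) = map (\<lambda>j. m (site ((s + j) mod L))) [0..<L]"
  by (rule nth_equalityI) (auto simp: word_def nth_rotate add.commute)

lemma fire_site:
  assumes "L \<ge> 3" "s < L" "j < L"
  shows "fire 1 L (site ((s + 1) mod L)) m (site ((s + j) mod L)) =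
    m (site ((s + j) mod L)) + (if j = 1 then -2 else if j = 0 \<or> j = 2 then 1 else 0)"
proof -
  let ?t = "(s + 1) mod L"
  have "?t < L" using assms by simp
  moreover have "(?t + 1) mod L = (s + 2) mod L"
    by (simp add: mod_Suc_eq)
  \<comment> \<open>The summand 0 is kept so that \<open>inj\<close> applies to this neighbour with
    \<open>k = 0\<close>.\<close>
  moreover have "(?t + L - 1) mod L = (s + 0) mod L"
  proof (cases "s + 1 = L")
    case False
    then have "?t + L - 1 = s + L" using assms by simp
    then show ?thesis by simp
  qed (use assms in auto)
  ultimately have nb: "neighbors 1 L (site ?t) = {site ((s + 2) mod L), site ((s + 0) mod L)}"
    using neighbors_1 by metis
  have "(s + j) mod L = (s + k) mod L \<longleftrightarrow> j = k" if "k < L" for k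
    using assms that by (auto simp: mod_if split: if_splits)
  then have inj: "site ((s + j) mod L) = site ((s + k) mod L) \<longleftrightarrow> j = k" if "k < L" for k
    unfolding site_eq_iff using that .
  have "0 < L" "1 < L" "2 < L" using assms(1) by simp_all
  note inj = this[THEN inj]
  show ?thesis
    unfolding fire_def nb insert_iff empty_iff inj coordination_def by auto
qed

lemma cyclic_defects_update:
  assumes L: "L \<ge> 3" and m: "m \<in> configs 1 L" "fire 1 L v m \<in> configs 1 L" and v: "v \<in> vertices 1 L"
  shows "\<exists>s. cyclic_defects (rotate s (word L (fire 1 L v m))) = cyclic_defects (rotate s (word L m))"
proof -
  obtain t where t: "t < L" "v = site t"
    using v vertices_1 by auto
  \<comment> \<open>The cyclic predecessor of the fired site: after rotation by \<open>s\<close> the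
    fired site has index 1 and its neighbours have indices 0 and 2, so the window does not wrap
    around.\<close>
  define s where "s = (t + L - 1) mod L"
  have s: "s < L" using L by (simp add: s_def)
  have "(s + 1) mod L = t"
    using t(1) L unfolding s_def by (auto simp: mod_if)
  then have f: "fire 1 L v m (site ((s + j) mod L)) =
    m (site ((s + j) mod L)) + (if j = 1 then -2 else if j = 0 \<or> j = 2 then 1 else 0)" if "j < L" for j
    using fire_site[OF L s that, of m] t(2) by simp
  let ?w = "\<lambda>j. m (site ((s + j) mod L))"
  have rng: "?w j \<in> {0..2}" "fire 1 L v m (site ((s + j) mod L)) \<in> {0..2}" if "j < L" for j
  proof -
    have "site ((s + j) mod L) \<in> vertices 1 L"
      using that unfolding vertices_1 by simp
    then show "?w j \<in> {0..2}" "fire 1 L v m (site ((s + j) mod L)) \<in> {0..2}"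
      using m by (auto simp: configs_def coordination_def PiE_iff)
  qed
  have up: "[0..<L] = 0 # 1 # 2 # [3..<L]"
    using L by (simp add: upt_conv_Cons numeral_eq_Suc)
  have "rotate s (word L m) = ?w 0 # ?w 1 # ?w 2 # map ?w [3..<L]"
    unfolding rotate_word up by simp
  moreover have "rotate s (word L (fire 1 L v m)) = (?w 0 + 1) # (?w 1 - 2) # (?w 2 + 1) # map ?w [3..<L]"
  proof -
    have "map (\<lambda>j. fire 1 L v m (site ((s + j) mod L))) [3..<L] = map ?w [3..<L]"
      by (rule map_cong[OF refl]) (use f in simp)
    then show ?thesis
      unfolding rotate_word up list.map using f[of 0] f[of 1] f[of 2] L by simp
  qed
  \<comment> \<open>The bounds on letters before and after the firing force a full fired site and
    neighbours with room for one more particle.\<close>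
  moreover have "?w 0 \<in> {0, 1}" "?w 1 = 2" "?w 2 \<in> {0, 1}"
    using rng[of 0] rng[of 1] rng[of 2] f[of 0] f[of 1] f[of 2] L by auto
  ultimately have "cyclic_defects (rotate s (word L (fire 1 L v m))) = cyclic_defects (rotate s (word L m))"
    using cyclic_defects_fire[of "?w 0" "?w 2"] by simp
  then show ?thesis ..
qed

text \<open>Invariance holds only up to rotation, because each update is compared after rotating its
  window to the front.\<close>

lemma cyclic_defects_connected:
  assumes "(m, m') \<in> (allowed_updates 1 L)\<^sup>*" "L \<ge> 3"
  shows "\<exists>k. cyclic_defects (word L m') = rotate k (cyclic_defects (word L m))"
  using assms(1)
proof (induction rule: rtrancl_induct)
  case base
  show ?case by (rule exI[of _ 0]) simp
next
  case (step m' m'')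
  then obtain k where k: "cyclic_defects (word L m') = rotate k (cyclic_defects (word L m))"
    by blast
  obtain v where v: "v \<in> vertices 1 L" "m' \<in> configs 1 L" "m'' \<in> configs 1 L"
    and "m'' = fire 1 L v m' \<or> m'' = antifire 1 L v m'"
    using step.hyps by (auto simp: allowed_updates_def)
  then have "m'' = fire 1 L v m' \<or> m' = fire 1 L v m''"
    by (auto simp: fire_antifire)
  then obtain s where s: "cyclic_defects (rotate s (word L m'')) = cyclic_defects (rotate s (word L m'))"
    using cyclic_defects_update[OF assms(2) _ _ v(1)] v(2,3) by metis
  obtain j where j: "cyclic_defects (rotate s (word L m')) = rotate j (cyclic_defects (word L m'))"
    using cyclic_defects_rotate by blast
  \<comment> \<open>Rotation by \<open>r\<close> undoes rotation by \<open>s\<close>, as the total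
    \<open>L * s\<close> is a multiple of the length of the word.\<close>
  define r where "r = L * s - s"
  have "r + s = L * s"
    using assms(2) by (simp add: r_def)
  then have "rotate r (rotate s (word L m'')) = word L m''"
    by (simp add: rotate_rotate rotate_id word_def)
  then obtain i where "cyclic_defects (word L m'') = rotate i (cyclic_defects (rotate s (word L m'')))"
    using cyclic_defects_rotate by metis
  then have "cyclic_defects (word L m'') = rotate (i + (j + k)) (cyclic_defects (word L m))"
    by (simp add: s j k rotate_rotate)
  then show ?case ..
qed

text \<open>
  \<open>++--00\<close> and \<open>+--++-\<close>: both start with \<open>+\<close> and leave the last charge \<open>-\<close>, and they have equally many
  defects, but in the opposite order.
\<close>

definition pat0 :: "int list" where "pat0 = [2, 2, 0, 0, 1, 1]"
definition pat1 :: "int list" where "pat1 = [2, 0, 0, 2, 2, 0]"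

text \<open>Both patterns open with \<open>2\<close>, so the incoming charge adds the same optional
  defect; the remaining defects are \<open>[2, 0]\<close> and \<open>[0, 2]\<close>.\<close>

lemma pat_defects:
  "last_charge s pat0 = 0" "last_charge s pat1 = 0"
  "length (defects s pat0) = length (defects s pat1)" "defects s pat0 \<noteq> defects s pat1"
  by (auto simp: pat0_def pat1_def)

lemma length_pat: "length pat0 = 6" "length pat1 = 6"
  by (simp_all add: pat0_def pat1_def)

text \<open>Equal last charges and equal lengths are carried through the induction. They allow equal
  defect sequences to be split at the last block, where exchanged patterns would give different
  pieces.\<close>

lemma defects_determine_blocks:
  fixes f g :: "nat \<Rightarrow> int"
  assumes "\<And>i. i < k \<Longrightarrow> (\<forall>j<6. f (6 * i + j) = g (6 * i + j))
      \<or> (\<forall>j<6. f (6 * i + j) = pat0 ! j \<and> g (6 * i + j) = pat1 ! j)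
      \<or> (\<forall>j<6. f (6 * i + j) = pat1 ! j \<and> g (6 * i + j) = pat0 ! j)"
  shows "last_charge s (map f [0..<6 * k]) = last_charge s (map g [0..<6 * k])
    \<and> length (defects s (map f [0..<6 * k])) = length (defects s (map g [0..<6 * k]))
    \<and> (defects s (map f [0..<6 * k]) = defects s (map g [0..<6 * k]) \<longrightarrow> (\<forall>t<6 * k. f t = g t))"
  using assms
proof (induction k)
  case 0
  show ?case by simp
next
  case (Suc k)
  let ?F = "map f [0..<6 * k]" and ?G = "map g [0..<6 * k]"
  let ?B = "\<lambda>f :: nat \<Rightarrow> int. map (\<lambda>j. f (6 * k + j)) [0..<6]"
  have split: "map f [0..<6 * Suc k] = map f [0..<6 * k] @ ?B f" for f :: "nat \<Rightarrow> int"
    by (rule nth_equalityI) (auto simp: nth_append)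
  have IH: "last_charge s ?F = last_charge s ?G" "length (defects s ?F) = length (defects s ?G)"
    "defects s ?F = defects s ?G \<Longrightarrow> \<forall>t<6 * k. f t = g t"
    using Suc by auto
  have pat: "?B f = p" if "\<forall>j<6. f (6 * k + j) = p ! j" "length p = 6" for f p
    using that by (intro nth_equalityI) auto
  have "(\<forall>j<6. f (6 * k + j) = g (6 * k + j)) \<or> (?B f = pat0 \<and> ?B g = pat1) \<or> (?B f = pat1 \<and> ?B g = pat0)"
    using Suc.prems[of k] pat[of f] pat[of g] length_pat by blast
  then consider (same) "\<forall>j<6. f (6 * k + j) = g (6 * k + j)" "?B f = ?B g"
    | (01) "?B f = pat0" "?B g = pat1" | (10) "?B f = pat1" "?B g = pat0"
    by fastforce
  then show ?case
  proof cases
    case same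
    have "\<forall>t<6 * Suc k. f t = g t" if "\<forall>t<6 * k. f t = g t"
    proof (intro allI impI)
      fix t assume "t < 6 * Suc k"
      then show "f t = g t"
        using that same(1)[rule_format, of "t - 6 * k"] by (cases "t < 6 * k") auto
    qed
    then show ?thesis
      unfolding split same(2) last_charge_append defects_append using IH by simp
  next
    case 01
    then show ?thesis
      unfolding split last_charge_append defects_append using IH(1,2) pat_defects by simp
  next
    case 10
    then show ?thesis
      unfolding split last_charge_append defects_append using IH(1,2) pat_defects
      by (simp add: pat_defects(4)[symmetric])
  qed
qed

section \<open>Rigidity of six-site blocks on the ring\<close>

definition block :: "nat \<Rightarrow> (nat \<Rightarrow> int) set" where
  "block i = site ` {6 * i..<6 * i + 6}"

text \<open>The periodic extension of \<open>p\<close>; blocks start at multiples of 6, so each of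
  them reads \<open>p\<close> from its beginning.\<close>

definition pattern :: "int list \<Rightarrow> config" where
  "pattern p v = p ! (nat (v 0) mod 6)"

lemma pattern_site: "pattern p (site t) = p ! (t mod 6)"
  by (simp add: pattern_def site_apply)

lemma disjoint_blocks: "disjoint_family_on block I"
  by (auto simp: disjoint_family_on_def block_def site_eq_iff)

lemma block_rigidity:
  assumes sw: "switch {..<L div 6} block (pattern pat1) (pattern pat0) m
      = switch {..<L div 6} block (pattern pat1) (pattern pat0) m'"
    and eq: "cyclic_defects (word L m) = cyclic_defects (word L m')"
    and t: "t < L"
  shows "m (site t) = m' (site t)"
proof -
  let ?k = "L div 6"
  let ?f = "\<lambda>t. m (site t)" and ?g = "\<lambda>t. m' (site t)"
  have k: "6 * ?k \<le> L" by simp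
  have split: "word L m = map (\<lambda>t. m (site t)) [0..<6 * ?k] @ map (\<lambda>t. m (site t)) [6 * ?k..<L]" for m
    unfolding word_def map_append[symmetric]
    using upt_add_eq_append[of 0 "6 * ?k" "L - 6 * ?k"] k by simp
  have blocks: "(\<forall>j<6. ?f (6 * i + j) = ?g (6 * i + j))
      \<or> (\<forall>j<6. ?f (6 * i + j) = pat0 ! j \<and> ?g (6 * i + j) = pat1 ! j)
      \<or> (\<forall>j<6. ?f (6 * i + j) = pat1 ! j \<and> ?g (6 * i + j) = pat0 ! j)" if "i < ?k" for i
  proof -
    have "site (6 * i + j) \<in> block i" "pattern p (site (6 * i + j)) = p ! j" if "j < 6" for j p
      using that by (simp_all add: block_def pattern_site)
    then show ?thesis
      using switch_eq_cases[OF disjoint_blocks _ sw, of i] that by force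
  qed
  have tail: "?f t = ?g t" if "6 * ?k \<le> t" for t
  proof (rule switch_eq_outside[OF sw])
    fix i assume "i \<in> {..<?k}"
    then have "6 * i + 6 \<le> 6 * ?k" by simp
    then show "site t \<notin> block i"
      using that by (auto simp: block_def site_eq_iff)
  qed
  then have tails: "map ?f [6 * ?k..<L] = map ?g [6 * ?k..<L]"
    by simp
  note det = defects_determine_blocks[of ?k ?f ?g, OF blocks]
  \<comment> \<open>Both patterns leave the same charge behind, so the two defect sequences are
    computed from the same incoming charge.\<close>
  have "last_charge 0 (word L m) = last_charge 0 (word L m')"
    unfolding split last_charge_append tails using det by simp
  then have "defects (last_charge 0 (word L m)) (word L m) = defects (last_charge 0 (word L m)) (word L m')"
    using eq by (simp add: cyclic_defects_def)
  \<comment> \<open>The sites after the last full block agree and receive the same charge, so their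
    defects cancel as a common suffix.\<close>
  moreover have "defects s (map ?f [0..<6 * ?k]) = defects s (map ?g [0..<6 * ?k])"
    if "defects s (word L m) = defects s (word L m')" for s
    using that det[of s] unfolding split defects_append tails by simp
  ultimately have "defects (last_charge 0 (word L m)) (map ?f [0..<6 * ?k])
      = defects (last_charge 0 (word L m)) (map ?g [0..<6 * ?k])"
    by blast
  then have "\<forall>t<6 * ?k. ?f t = ?g t"
    using det by blast
  with tail show ?thesis
    by (cases "t < 6 * ?k") auto
qed

text \<open>On a fibre within a component the cyclic defect sequence is injective, and its values
  are rotations of one list of length at most \<open>L\<close>. Hence \<open>K = L\<close>, and six
  sites with three letters give \<open>3 ^ 6\<close>.\<close>

lemma component_bound_dim_1:
  assumes L: "L \<ge> 3" and C: "C \<in> components 1 L"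
  shows "real (card C) \<le> real L * exp (- real (L div 6) / 3 ^ 6) * real (card (configs 1 L))"
proof -
  let ?sw = "switch {..<L div 6} block (pattern pat1) (pattern pat0)"
  have fibre: "card {m \<in> C. ?sw m = b} \<le> L" for b
  proof (cases "{m \<in> C. ?sw m = b} = {}")
    case False
    then obtain m0 where m0: "m0 \<in> C" by blast
    let ?D = "cyclic_defects (word L m0)"
    let ?h = "\<lambda>m. cyclic_defects (word L m)"
    have "inj_on ?h {m \<in> C. ?sw m = b}"
    proof (rule inj_onI)
      fix m m' assume m: "m \<in> {m \<in> C. ?sw m = b}" "m' \<in> {m \<in> C. ?sw m = b}" "?h m = ?h m'"
      then have "m \<in> configs 1 L" "m' \<in> configs 1 L" "?sw m = ?sw m'"
        using component_subset[OF C] by auto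
      then show "m = m'"
        unfolding configs_def using block_rigidity[OF _ m(3)] vertices_1
        by (intro PiE_ext[of m "vertices 1 L"]) auto
    qed
    moreover have "?h ` {m \<in> C. ?sw m = b} \<subseteq> (\<lambda>k. rotate k ?D) ` {..<L}"
    proof (rule image_subsetI)
      fix m assume "m \<in> {m \<in> C. ?sw m = b}"
      then obtain k where k: "?h m = rotate k ?D"
        using cyclic_defects_connected[OF component_connected[OF C m0] L] by blast
      have D: "length ?D \<le> L"
        using length_defects[of _ "word L m0"] by (simp add: cyclic_defects_def word_def)
      show "?h m \<in> (\<lambda>k. rotate k ?D) ` {..<L}"
      proof (cases "?D = []")
        \<comment> \<open>Here \<open>k mod 0\<close> is \<open>k\<close>, which need not be below
          \<open>L\<close>; the index 0 serves instead.\<close>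
        case True
        with k L show ?thesis by (intro image_eqI[of _ _ 0]) auto
      next
        case False
        then have "k mod length ?D < length ?D" by simp
        with D have "k mod length ?D < L" by linarith
        moreover have "?h m = rotate (k mod length ?D) ?D"
          unfolding k by (rule rotate_conv_mod)
        ultimately show ?thesis by (intro image_eqI[of _ _ "k mod length ?D"]) auto
      qed
    qed
    ultimately have "card {m \<in> C. ?sw m = b} \<le> card ((\<lambda>k. rotate k ?D) ` {..<L})"
      by (rule card_inj_on_le) simp
    also have "\<dots> \<le> L"
      using card_image_le[of "{..<L}" "\<lambda>k. rotate k ?D"] by simp
    finally show ?thesis .
  next
    case True
    show ?thesis unfolding True by simp
  qed
  have pat: "pattern p \<in> vertices 1 L \<rightarrow> {0..int (coordination 1)}" if "p = pat0 \<or> p = pat1" for p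
  proof
    fix v :: "nat \<Rightarrow> int"
    have "p ! (nat (v 0) mod 6) \<in> set p"
      using that length_pat by (intro nth_mem) auto
    then show "pattern p v \<in> {0..int (coordination 1)}"
      using that by (auto simp: pattern_def pat0_def pat1_def coordination_def)
  qed
  have "real (card C) \<le> real L * exp (- real (card {..<L div 6}) / real (card {0..int (coordination 1)} ^ 6))
      * real (card (vertices 1 L \<rightarrow>\<^sub>E {0..int (coordination 1)}))"
  proof (rule card_le_switch_fibres[OF _ finite_vertices _ _ _ disjoint_blocks _ _ _ _ fibre])
    show "block i \<subseteq> vertices 1 L" if "i \<in> {..<L div 6}" for i
    proof -
      have "6 * i + 6 \<le> L" using that by simp
      then show ?thesis unfolding block_def vertices_1 by auto
    qed
    show "card (block i) = 6" for i
      by (simp add: block_def card_image inj_on_def site_eq_iff)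
    show "\<exists>v\<in>block i. pattern pat0 v \<noteq> pattern pat1 v" for i
      by (intro bexI[of _ "site (6 * i + 1)"])
        (simp_all add: block_def pattern_site pat0_def pat1_def)
    show "C \<subseteq> vertices 1 L \<rightarrow>\<^sub>E {0..int (coordination 1)}"
      using component_subset[OF C] by (simp add: configs_def)
  qed (use pat in auto)
  then show ?thesis
    by (simp add: configs_def coordination_def)
qed

section \<open>Exponential rates from the component bounds\<close>

theorem theorem2:
  fixes d :: nat
  assumes "d \<ge> 1"
  shows "\<exists>c::real. c > 0 \<and> (\<exists>L0::nat. \<forall>L\<ge>L0.
           real (Max (card ` components d L)) / real (card (configs d L))
             \<le> exp (- c * real (L ^ d)))"
proof -
  have bound: "real (Max (card ` components d L)) / real (card (configs d L)) \<le> b"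
    if "\<And>C. C \<in> components d L \<Longrightarrow> real (card C) \<le> b * real (card (configs d L))" for L b
  proof -
    have "Max (card ` components d L) \<in> card ` components d L"
      by (intro Max_in) (simp_all add: finite_components components_nonempty)
    then obtain C where "C \<in> components d L" "Max (card ` components d L) = card C"
      by auto
    moreover have "card (configs d L) > 0"
      using finite_configs configs_nonempty by (simp add: card_gt_0_iff)
    ultimately show ?thesis
      using that by (simp add: divide_le_eq)
  qed
  show ?thesis
  proof (cases "d = 1")
    case True
    \<comment> \<open>The rate \<open>1 / 8748\<close> is half of \<open>1 / (6 * 729)\<close>; the
      other half absorbs the factor \<open>L\<close>.\<close>
    have "eventually (\<lambda>L. real L * exp (- (real L / 6 - 1) / 729) \<le> exp (- (1 / 8748) * real L)) sequentially"
      by real_asymp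
    then obtain L0 where L0:
      "\<And>L. L \<ge> L0 \<Longrightarrow> real L * exp (- (real L / 6 - 1) / 729) \<le> exp (- (1 / 8748) * real L)"
      unfolding eventually_sequentially by blast
    have "real (Max (card ` components d L)) / real (card (configs d L)) \<le> exp (- (1 / 8748) * real (L ^ d))"
      if L: "L \<ge> max L0 3" for L
    proof (rule bound)
      fix C assume C: "C \<in> components d L"
      have "L \<le> 6 * (L div 6) + 6" by presburger
      then have "real L / 6 - 1 \<le> real (L div 6)" by linarith
      then have "real L * exp (- real (L div 6) / 3 ^ 6) \<le> real L * exp (- (real L / 6 - 1) / 729)"
        by (intro mult_left_mono) auto
      also have "\<dots> \<le> exp (- (1 / 8748) * real (L ^ d))"
        using L0[of L] L True by simp
      finally show "real (card C) \<le> exp (- (1 / 8748) * real (L ^ d)) * real (card (configs d L))"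
        using component_bound_dim_1[of L C] C L unfolding True
        by (meson mult_right_mono of_nat_0_le_iff order_trans max.boundedE)
    qed
    then show ?thesis
      by (intro exI[of _ "1 / 8748"] conjI exI[of _ "max L0 3"]) auto
  next
    case False
    with assms have d: "d \<ge> 2" by simp
    \<comment> \<open>The factor \<open>3 ^ d\<close> comes from \<open>L div 2 \<ge> L / 3\<close>
      for \<open>L \<ge> 3\<close>, the other one from the contents of a dipole.\<close>
    define c where "c = 1 / (3 ^ d * real ((2 * d + 1) ^ 2))"
    have "real (Max (card ` components d L)) / real (card (configs d L)) \<le> exp (- c * real (L ^ d))"
      if L: "L \<ge> 3" for L
    proof (rule bound)
      fix C assume C: "C \<in> components d L"
      have "L \<le> 3 * (L div 2)" using L by presburger
      then have "real L / 3 \<le> real (L div 2)" by linarith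
      then have "(real L / 3) ^ d \<le> real (L div 2) ^ d"
        by (intro power_mono) auto
      then have "(real L / 3) ^ d / real ((2 * d + 1) ^ 2) \<le> real (L div 2) ^ d / real ((2 * d + 1) ^ 2)"
        by (intro divide_right_mono) auto
      then have "c * real (L ^ d) \<le> real ((L div 2) ^ d) / real ((2 * d + 1) ^ 2)"
        by (simp add: c_def power_divide)
      then have "exp (- real ((L div 2) ^ d) / real ((2 * d + 1) ^ 2)) \<le> exp (- c * real (L ^ d))"
        by simp
      then show "real (card C) \<le> exp (- c * real (L ^ d)) * real (card (configs d L))"
        using component_bound_high_dim[OF d L C]
        by (meson mult_right_mono of_nat_0_le_iff order_trans)
    qed
    moreover have "c > 0"
      by (simp add: c_def)
    ultimately show ?thesis by blast
  qed
qed

end
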